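(* In the screening model described in the context (with primitives $a_H,a_L,v,\delta,\bar\varepsilon>0$, feasible requirements $\mathcal R=[\underline r,\bar r]$, and cost functions $K_H\le K_L$), the tie-broken optimal action is never rejection at any posterior $p\in[0,1]$ if and only if at least one of the following two conditions holds: (C) there exists $r\in\mathcal R$ such that $K_L(r)<v$ and $r\ge a_L/\delta$; (S) there exists $r\in\mathcal R$ such that $K_L(r)\ge v$.
   Context: Primitives: real numbers $a_H>0$, $a_L>0$, $v>0$, $\delta>0$, $\bar\varepsilon>0$; a compact interval $\mathcal R=[\underline r,\bar r]$ with $0<\underline r\le\bar r$; for each type $\theta\in\{H,L\}$ a twice differentiable function $K_\theta:\mathcal R\to\mathbb R$ with $K_\theta\ge 0$, $K_\theta'>0$, $K_\theta''\ge 0$ on $\mathcal R$ (derivatives one-sided at endpoints), and $K_H(r)\le K_L(r)$ for all $r\in\mathcal R$. Completion probabilities (the probability that $K_\theta(r)+\varepsilon\le v$ when $\varepsilon$ is uniform on $[0,\bar\varepsilon]$): $$q_\theta(r)=\min\left\{\max\left\{\frac{v-K_\theta(r)}{\bar\varepsilon},0\right\},1\right\}.$$ At posterior belief $p\in[0,1]$ (the probability that the applicant is of type $H$), the principal chooses one of: accept ($A$), reject ($R$), or offer recourse with some requirement $r\in\mathcal R$ ($(O,r)$). The payoffs are $$U^A(p)=pa_H-(1-p)a_L,\qquad U^R=0,\qquad U^O(p,r)=p\,q_H(r)(a_H+\delta r)+(1-p)\,q_L(r)(-a_L+\delta r).$$ Let $V^O(p)=\max_{r\in\mathcal R}U^O(p,r)$.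 Tie-broken optimal action at $p$: the principal picks an action with the largest payoff, and if two actions give the same payoff, chooses accept over recourse, accept over reject, and recourse over reject. That is: accept if $U^A(p)\ge\max\{0,V^O(p)\}$; otherwise offer recourse (with a requirement attaining $V^O(p)$) if $V^O(p)\ge 0$; otherwise reject. *)

theory Defs
  imports "HOL-Analysis.Analysis"
begin

datatype applicant = High | Low

datatype decision = Accept | Reject | Offer real

(* In smooth_cost, the filter "at r within {rlo..rhi}" makes the derivatives one-sided
   at the end points.  If rlo = rhi that filter is trivial and the existential
   requirement holds for every K, so a single feasible requirement is allowed. *)
locale screening_model =
  fixes aH aL v \<delta> \<epsilon> rlo rhi :: real
    and K :: "applicant \<Rightarrow> real \<Rightarrow> real"
  assumes aH_pos: "aH > 0"
    and aL_pos: "aL > 0"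
    and v_pos: "v > 0"
    and \<delta>_pos: "\<delta> > 0"
    and \<epsilon>_pos: "\<epsilon> > 0"
    and rlo_pos: "0 < rlo"
    and rlo_le_rhi: "rlo \<le> rhi"
    and cost_nonneg: "\<And>\<theta> r. r \<in> {rlo..rhi} \<Longrightarrow> K \<theta> r \<ge> 0"
    and smooth_cost: "\<And>\<theta>. \<exists>K' K''. \<forall>r\<in>{rlo..rhi}.
          (K \<theta> has_real_derivative K' r) (at r within {rlo..rhi}) \<and>
          (K' has_real_derivative K'' r) (at r within {rlo..rhi}) \<and>
          K' r > 0 \<and> K'' r \<ge> 0"
    and cost_High_le_Low: "\<And>r. r \<in> {rlo..rhi} \<Longrightarrow> K High r \<le> K Low r"
begin

definition q :: "applicant \<Rightarrow> real \<Rightarrow> real" where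
  "q \<theta> r = min (max ((v - K \<theta> r) / \<epsilon>) 0) 1"

definition U_accept :: "real \<Rightarrow> real" where
  "U_accept p = p * aH - (1 - p) * aL"

definition U_reject :: real where
  "U_reject = 0"

definition U_offer :: "real \<Rightarrow> real \<Rightarrow> real" where
  "U_offer p r = p * q High r * (aH + \<delta> * r) + (1 - p) * q Low r * (- aL + \<delta> * r)"

(* The supremum is attained, see V_offer_attained and V_offer_upper below. *)
definition V_offer :: "real \<Rightarrow> real" where
  "V_offer p = (SUP r\<in>{rlo..rhi}. U_offer p r)"

definition optimal_decision :: "real \<Rightarrow> decision" where
  "optimal_decision p =
     (if U_accept p \<ge> max U_reject (V_offer p) then Accept
      else if V_offer p \<ge> U_reject then Offer (SOME r. r \<in> {rlo..rhi} \<and> U_offer p r = V_offer p)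
      else Reject)"

lemma continuous_on_U_offer: "continuous_on {rlo..rhi} (U_offer p)"
proof -
  have K: "continuous_on {rlo..rhi} (K \<theta>)" for \<theta>
    using smooth_cost[of \<theta>] by (metis DERIV_continuous_on)
  show ?thesis
    unfolding U_offer_def q_def
    using \<epsilon>_pos by (intro continuous_intros K) auto
qed

lemma V_offer_max: "\<exists>r\<in>{rlo..rhi}. U_offer p r = V_offer p \<and> (\<forall>s\<in>{rlo..rhi}. U_offer p s \<le> V_offer p)"
proof -
  obtain r where r: "r \<in> {rlo..rhi}" "\<forall>s\<in>{rlo..rhi}. U_offer p s \<le> U_offer p r"
    using continuous_attains_sup[OF compact_Icc _ continuous_on_U_offer[of p]] rlo_le_rhi
    by auto
  have "V_offer p = U_offer p r"
    unfolding V_offer_def using r by (intro cSup_eq_maximum) auto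
  with r show ?thesis by auto
qed

lemma V_offer_attained: "\<exists>r\<in>{rlo..rhi}. U_offer p r = V_offer p"
  using V_offer_max by blast

lemma V_offer_upper: "r \<in> {rlo..rhi} \<Longrightarrow> U_offer p r \<le> V_offer p"
  using V_offer_max by blast

end

end

theory Submission
  imports Defs
begin

text \<open>Rejection is optimal exactly where accepting and every offer have negative payoff. The high
  type contributes a nonnegative amount to the payoff of an offer, so an offer that is not loss-making
  at \<open>p = 0\<close> is not loss-making at any belief. Hence \<open>p = 0\<close>, where accepting costs \<open>aL\<close>, decides.\<close>

context screening_model
begin

lemma q_nonneg: "q \<theta> r \<ge> 0"
  by (simp add: q_def)

lemma q_pos_iff: "q \<theta> r > 0 \<longleftrightarrow> K \<theta> r < v"
  using \<epsilon>_pos by (simp add: q_def min_less_iff_conj less_max_iff_disj zero_less_divide_iff)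

text \<open>Both inequalities are strict because ties are always resolved against rejection.\<close>

lemma optimal_decision_eq_Reject_iff:
  "optimal_decision p = Reject \<longleftrightarrow> U_accept p < 0 \<and> V_offer p < 0"
  by (auto simp: optimal_decision_def U_reject_def)

text \<open>Attainment matters for the forward direction: a supremum equal to 0 could otherwise be
  approached by negative payoffs only.\<close>

lemma V_offer_nonneg_iff: "V_offer p \<ge> 0 \<longleftrightarrow> (\<exists>r\<in>{rlo..rhi}. U_offer p r \<ge> 0)"
  by (metis V_offer_attained V_offer_upper order_trans)

text \<open>At belief 0 only the product \<open>q Low r * (- aL + \<delta> * r)\<close> survives.
  Its first factor is never negative, so the product is nonnegative iff that factor vanishes or the
  second one is nonnegative.\<close>

lemma U_offer_0_nonneg_iff: "U_offer 0 r \<ge> 0 \<longleftrightarrow> K Low r < v \<and> r \<ge> aL / \<delta> \<or> K Low r \<ge> v"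
proof -
  have "U_offer 0 r \<ge> 0 \<longleftrightarrow> q Low r = 0 \<or> aL \<le> \<delta> * r"
    using q_nonneg[of Low r] by (auto simp: U_offer_def zero_le_mult_iff)
  moreover have "q Low r = 0 \<longleftrightarrow> K Low r \<ge> v"
    using q_nonneg[of Low r] q_pos_iff[of Low r] by linarith
  moreover have "aL \<le> \<delta> * r \<longleftrightarrow> r \<ge> aL / \<delta>"
    using \<delta>_pos by (simp add: pos_divide_le_eq mult.commute)
  ultimately show ?thesis
    by auto
qed

lemma U_offer_nonneg_of_0:
  assumes "p \<in> {0..1}" "r \<in> {rlo..rhi}" "U_offer 0 r \<ge> 0"
  shows "U_offer p r \<ge> 0"
proof -
  have "aH + \<delta> * r \<ge> 0"
    using assms(2) aH_pos \<delta>_pos rlo_pos by simp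
  then have "p * q High r * (aH + \<delta> * r) \<ge> 0"
    using assms(1) q_nonneg by simp
  \<comment> \<open>This is exactly the low type's share of \<open>U_offer p r\<close>.\<close>
  moreover have "(1 - p) * U_offer 0 r \<ge> 0"
    using assms by simp
  ultimately show ?thesis
    by (simp add: U_offer_def mult.assoc)
qed

lemma never_Reject_iff:
  "(\<forall>p\<in>{0..1}. optimal_decision p \<noteq> Reject) \<longleftrightarrow> (\<exists>r\<in>{rlo..rhi}. U_offer 0 r \<ge> 0)"
proof
  assume "\<forall>p\<in>{0..1}. optimal_decision p \<noteq> Reject"
  then have "optimal_decision 0 \<noteq> Reject"
    by simp
  then have "V_offer 0 \<ge> 0"
    \<comment> \<open>Since \<open>U_accept 0 = - aL\<close> is negative, only an offer can avert
      rejection here.\<close>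
    using aL_pos by (auto simp: optimal_decision_eq_Reject_iff U_accept_def)
  then show "\<exists>r\<in>{rlo..rhi}. U_offer 0 r \<ge> 0"
    by (simp only: V_offer_nonneg_iff)
next
  assume "\<exists>r\<in>{rlo..rhi}. U_offer 0 r \<ge> 0"
  then have "V_offer p \<ge> 0" if "p \<in> {0..1}" for p
    using that U_offer_nonneg_of_0 V_offer_nonneg_iff by blast
  then show "\<forall>p\<in>{0..1}. optimal_decision p \<noteq> Reject"
    by (simp add: optimal_decision_eq_Reject_iff linorder_not_less)
qed

end

theorem proposition1:
  fixes aH aL v \<delta> \<epsilon> rlo rhi :: real
    and K :: "applicant \<Rightarrow> real \<Rightarrow> real"
  assumes "screening_model aH aL v \<delta> \<epsilon> rlo rhi K"
  shows "(\<forall>p\<in>{0..1}. screening_model.optimal_decision aH aL v \<delta> \<epsilon> rlo rhi K p \<noteq> Reject) \<longleftrightarrow>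
           (\<exists>r\<in>{rlo..rhi}. K Low r < v \<and> r \<ge> aL / \<delta>) \<or>
           (\<exists>r\<in>{rlo..rhi}. K Low r \<ge> v)"
proof -
  interpret screening_model aH aL v \<delta> \<epsilon> rlo rhi K
    by (fact assms)
  show ?thesis
    unfolding never_Reject_iff U_offer_0_nonneg_iff by blast
qed

end
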